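(* Let $n,s,\mu$ be integers with $0\le s\le n-1$ and $1\le\mu\le n-s$, and let $p(z)$ be a polynomial of degree $n$ with complex coefficients of the form $$p(z)=(z-z_0)^s\left(a_0+\sum_{v=\mu}^{n-s}a_vz^v\right).$$ Let $k\ge 1$ be real and let $\alpha\in\mathbb{C}$ with $|\alpha|\ge 1$. If the zero $z_0$ is in $D(0,1)$ and the remaining $n-s$ zeros of $p$ are outside $D(0,k)$, then $$\max_{|z|=1}|D_\alpha p(z)|\le\left[n+(|\alpha|-1)\left(\frac{s}{1-|z_0|}+\frac{A}{(1-|z_0|)^s}\right)\right]\max_{|z|=1}|p(z)|-\left[\frac{(|\alpha|-1)A}{(k+|z_0|)^s}\right]\min_{|z|=k}|p(z)|,$$ where $$A=\frac{(1+|z_0|)^{s+1}(n-s)}{(1+k^\mu)(1-|z_0|)}.$$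
   Context: For real $k>0$, $D(0,k)=\{z\in\mathbb{C}:|z|<k\}$ denotes the open disk; "outside $D(0,k)$" means $|z|\ge k$. For a polynomial $p$ of degree $n$ and $\alpha\in\mathbb{C}$, the polar derivative of $p$ with respect to $\alpha$ is $D_\alpha p(z)=np(z)+(\alpha-z)p'(z)$. The "remaining $n-s$ zeros" are the zeros, counted with multiplicity, of the factor $a_0+\sum_{v=\mu}^{n-s}a_vz^v$. *)

theory Defs
  imports "HOL-Analysis.Analysis" "HOL-Computational_Algebra.Polynomial"
begin

definition polar_deriv :: "complex \<Rightarrow> complex poly \<Rightarrow> complex poly" where
  "polar_deriv \<alpha> p = smult (of_nat (degree p)) p + [:\<alpha>, -1:] * pderiv p"

lemma poly_polar_deriv:
  "poly (polar_deriv \<alpha> p) z = of_nat (degree p) * poly p z + (\<alpha> - z) * poly (pderiv p) z"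
  by (simp add: polar_deriv_def algebra_simps)

text \<open>
  The supremum and infimum below are attained for \<open>r \<ge> 0\<close>, as the two lemmas after them show, so
  they are the maximum and the minimum of the modulus on the circle. (\<open>Max\<close> and \<open>Min\<close> are
  meaningful only on finite sets.)
\<close>

definition max_modulus :: "real \<Rightarrow> complex poly \<Rightarrow> real" where
  "max_modulus r p = (SUP z\<in>sphere 0 r. cmod (poly p z))"

definition min_modulus :: "real \<Rightarrow> complex poly \<Rightarrow> real" where
  "min_modulus r p = (INF z\<in>sphere 0 r. cmod (poly p z))"

lemma max_modulus_attained:
  assumes "r \<ge> 0"
  shows "\<exists>w\<in>sphere 0 r. cmod (poly p w) = max_modulus r p \<and>
           (\<forall>z\<in>sphere 0 r. cmod (poly p z) \<le> cmod (poly p w))"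
proof -
  have "compact (sphere (0::complex) r)" "sphere (0::complex) r \<noteq> {}"
    using assms by auto
  moreover have "continuous_on (sphere 0 r) (\<lambda>z. cmod (poly p z))"
    by (intro continuous_intros)
  ultimately obtain w where w: "w \<in> sphere 0 r"
      "\<forall>z\<in>sphere 0 r. cmod (poly p z) \<le> cmod (poly p w)"
    using continuous_attains_sup by blast
  then have "max_modulus r p = cmod (poly p w)"
    unfolding max_modulus_def by (intro cSup_eq_maximum) auto
  with w show ?thesis by auto
qed

lemma min_modulus_attained:
  assumes "r \<ge> 0"
  shows "\<exists>w\<in>sphere 0 r. cmod (poly p w) = min_modulus r p \<and>
           (\<forall>z\<in>sphere 0 r. cmod (poly p w) \<le> cmod (poly p z))"
proof -
  have "compact (sphere (0::complex) r)" "sphere (0::complex) r \<noteq> {}"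
    using assms by auto
  moreover have "continuous_on (sphere 0 r) (\<lambda>z. cmod (poly p z))"
    by (intro continuous_intros)
  ultimately obtain w where w: "w \<in> sphere 0 r"
      "\<forall>z\<in>sphere 0 r. cmod (poly p w) \<le> cmod (poly p z)"
    using continuous_attains_inf by blast
  then have "min_modulus r p = cmod (poly p w)"
    unfolding min_modulus_def by (intro cInf_eq_minimum) auto
  with w show ?thesis by auto
qed

end

theory Submission
  imports Defs "HOL-Complex_Analysis.Conformal_Mappings"
    "HOL-Computational_Algebra.Fundamental_Theorem_Algebra"
begin

text \<open>
  Put \<open>m = n - s\<close>. For a polynomial \<open>G\<close> of degree at most \<open>m\<close> without zeros in \<open>|z| < k\<close>, every
  summand of \<open>z G'/G = \<Sum> z/(z - c)\<close> has real part at most \<open>1/2\<close>, so \<open>|z G'| \<le> |m G - z G'|\<close>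
  there. If the coefficients of \<open>z, \<dots>, z^(\<mu> - 1)\<close> vanish, the quotient of the two sides has a zero of
  order \<open>\<mu>\<close> at \<open>0\<close>, and Schwarz's lemma gives \<open>k^\<mu> |G'| \<le> |m G - z G'|\<close> on the unit circle.
  Applied to \<open>G = q - c\<close> with \<open>|c| < min |q|\<close> on \<open>|z| = k\<close>, this becomes
  \<open>k^\<mu> |q'| \<le> |m q - z q'| - m min |q|\<close>. Applied to \<open>G = q - c\<close> with \<open>|c| > max |q|\<close> on the unit
  circle, the case \<open>k = 1\<close>, \<open>\<mu> = 0\<close> gives \<open>|q'| + |m q - z q'| \<le> m max |q|\<close>. The sum of the two is
  the bound \<open>(1 + k^\<mu>) |q'| \<le> m (max |q| - min |q|)\<close>. The product rule for \<open>p = (z - z\<^sub>0)^s q\<close>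
  turns it into a bound for \<open>p'\<close>, and \<open>|D\<^sub>\<alpha> p| \<le> (|p'| + |n p - z p'|) + (|\<alpha>| - 1) |p'|\<close>.
\<close>

section \<open>Logarithmic derivatives of polynomials without zeros in a disk\<close>

text \<open>\<open>2 * Re (z / (z - c)) - 1\<close> is \<open>Re ((z + c) / (z - c))\<close>, which
  has the sign of \<open>|z|^2 - |c|^2\<close>.\<close>

lemma Re_divide_diff_le_half:
  fixes z c :: complex
  assumes "cmod z \<le> cmod c" "z \<noteq> c"
  shows "Re (z / (z - c)) \<le> 1 / 2"
proof -
  have "(Re z)\<^sup>2 + (Im z)\<^sup>2 \<le> (Re c)\<^sup>2 + (Im c)\<^sup>2"
    using power_mono[OF assms(1), of 2] by (simp add: cmod_power2)
  moreover have "(Re z - Re c)\<^sup>2 + (Im z - Im c)\<^sup>2 > 0"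
    using assms(2) by (simp add: sum_power2_gt_zero_iff complex_eq_iff)
  ultimately show ?thesis
    by (simp add: Re_divide divide_simps) (simp add: power2_eq_square algebra_simps)
qed

text \<open>Induction on the degree splits off one zero \<open>c\<close> at a time; each contributes
  a summand \<open>z / (z - c)\<close> of real part at most \<open>1/2\<close>.\<close>

lemma Re_log_derivative_le:
  assumes "\<forall>w\<in>ball 0 k. poly G w \<noteq> 0" "z \<in> ball 0 k"
  shows "Re (z * poly (pderiv G) z / poly G z) \<le> real (degree G) / 2"
  using assms(1)
proof (induction "degree G" arbitrary: G)
  case 0
  then obtain c where "G = [:c:]"
    using degree_eq_zeroE by metis
  then show ?case by (simp add: pderiv_pCons)
next
  case (Suc d)
  have "\<not> constant (poly G)"
    using Suc.hyps(2) by (simp add: constant_degree)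
  then obtain c where c: "poly G c = 0"
    using fundamental_theorem_of_algebra by blast
  then obtain R where G: "G = [:- c, 1:] * R"
    using poly_eq_0_iff_dvd by (metis dvdE)
  have "R \<noteq> 0"
    using Suc.hyps(2) G by auto
  then have dR: "degree G = Suc (degree R)"
    unfolding G by (subst degree_mult_eq) auto
  have R: "\<forall>w\<in>ball 0 k. poly R w \<noteq> 0"
    using Suc.prems G by auto
  have IH: "Re (z * poly (pderiv R) z / poly R z) \<le> real (degree R) / 2"
    using Suc.hyps(1)[OF _ R] Suc.hyps(2) dR by simp
  have "c \<notin> ball 0 k"
    using Suc.prems c by blast
  with assms(2) have zc: "cmod z \<le> cmod c" "z \<noteq> c"
    by auto
  have "z * poly (pderiv G) z / poly G z = z / (z - c) + z * poly (pderiv R) z / poly R z"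
    using zc(2) R assms(2) unfolding G pderiv_mult by (simp add: pderiv_pCons field_simps)
  with Re_divide_diff_le_half[OF zc] IH dR show ?case
    by (simp add: add_divide_distrib)
qed

text \<open>The difference of the squared moduli is \<open>x * (x - 2 * Re w)\<close>: the half
  plane in question consists of the points at least as close to \<open>0\<close> as to
  \<open>x\<close>.\<close>

lemma cmod_le_cmod_diff:
  fixes w :: complex
  assumes "2 * Re w \<le> x" "x \<ge> 0"
  shows "cmod w \<le> cmod (of_real x - w)"
proof -
  have "0 \<le> x * (x - 2 * Re w)"
    using assms by simp
  then have "(cmod w)\<^sup>2 \<le> (cmod (of_real x - w))\<^sup>2"
    unfolding cmod_power2 by (simp add: power2_eq_square algebra_simps)
  then show ?thesis
    by (rule power2_le_imp_le) simp
qed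

lemma cmod_pderiv_le:
  assumes "degree G \<le> n" "\<forall>w\<in>ball 0 k. poly G w \<noteq> 0" "z \<in> ball 0 k"
  shows "cmod (z * poly (pderiv G) z) \<le> cmod (of_nat n * poly G z - z * poly (pderiv G) z)"
proof -
  let ?w = "z * poly (pderiv G) z / poly G z"
  have nz: "poly G z \<noteq> 0"
    using assms by blast
  have "2 * Re ?w \<le> real n"
    using Re_log_derivative_le[OF assms(2,3)] assms(1) by linarith
  then have "cmod ?w \<le> cmod (of_nat n - ?w)"
    using cmod_le_cmod_diff[of ?w "real n"] by simp
  then have "cmod (poly G z) * cmod ?w \<le> cmod (poly G z) * cmod (of_nat n - ?w)"
    by (intro mult_left_mono) auto
  with nz show ?thesis
    unfolding norm_mult[symmetric] by (simp add: right_diff_distrib mult.commute)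
qed

section \<open>Maximum and minimum modulus principles\<close>

lemma poly_max_modulus_principle:
  assumes "z \<in> cball 0 r" "r > 0"
  shows "cmod (poly p z) \<le> max_modulus r p"
proof (rule maximum_modulus_frontier[where S = "cball 0 r" and f = "poly p"])
  show "poly p holomorphic_on interior (cball 0 r)"
    by (intro holomorphic_intros)
  show "continuous_on (closure (cball 0 r)) (poly p)"
    by (intro continuous_intros)
  show "cmod (poly p w) \<le> max_modulus r p" if "w \<in> frontier (cball 0 r)" for w
    using max_modulus_attained[of r p] that assms(2) by (auto simp: frontier_cball)
qed (use assms in auto)

text \<open>The maximum principle for \<open>1 / p\<close>. A positive minimum on the circle also
  excludes zeros there, so the reciprocal is continuous on the closed disk.\<close>

lemma poly_min_modulus_principle:
  assumes "\<forall>w\<in>ball 0 r. poly p w \<noteq> 0" "z \<in> cball 0 r" "r > 0"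
  shows "min_modulus r p \<le> cmod (poly p z)"
proof (cases "min_modulus r p \<le> 0")
  case True
  then show ?thesis using norm_ge_zero order_trans by blast
next
  case False
  then have pos: "min_modulus r p > 0" by simp
  have circ: "min_modulus r p \<le> cmod (poly p w)" if "w \<in> sphere 0 r" for w
    using min_modulus_attained[of r p] that assms(3) by auto
  have nz: "poly p w \<noteq> 0" if "w \<in> cball 0 r" for w
  proof (cases "w \<in> ball 0 r")
    case True
    then show ?thesis using assms(1) by blast
  next
    case False
    with that have "w \<in> sphere 0 r" by auto
    with circ pos show ?thesis by force
  qed
  have "cmod (1 / poly p z) \<le> 1 / min_modulus r p"
  proof (rule maximum_modulus_frontier[where S = "cball 0 r" and f = "\<lambda>w. 1 / poly p w"])
    show "(\<lambda>w. 1 / poly p w) holomorphic_on interior (cball 0 r)"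
      using nz by (intro holomorphic_intros) auto
    show "continuous_on (closure (cball 0 r)) (\<lambda>w. 1 / poly p w)"
      using nz by (intro continuous_intros) auto
    show "cmod (1 / poly p w) \<le> 1 / min_modulus r p" if "w \<in> frontier (cball 0 r)" for w
    proof -
      have "w \<in> sphere 0 r" using that assms(3) by (simp add: frontier_cball)
      from circ[OF this] pos show ?thesis by (simp add: norm_divide frac_le)
    qed
  qed (use assms in auto)
  then show ?thesis
    using pos nz[OF assms(2)] by (simp add: norm_divide divide_simps)
qed

section \<open>Schwarz's lemma for lacunary polynomials\<close>

lemma lacunary_pderiv_le:
  assumes deg: "degree G \<le> n" and lac: "\<forall>v. 0 < v \<and> v < \<mu> \<longrightarrow> coeff G v = 0"
    and nz: "\<forall>w\<in>ball 0 k. poly G w \<noteq> 0" and k: "k > 0" and z: "z \<in> cball 0 k"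
  shows "k ^ \<mu> * cmod (z * poly (pderiv G) z)
           \<le> cmod z ^ \<mu> * cmod (of_nat n * poly G z - z * poly (pderiv G) z)"
proof (cases "n = 0")
  case True
  with deg have "pderiv G = 0" by (simp add: pderiv_eq_0_iff)
  then show ?thesis by simp
next
  case n: False
  define N where "N = pCons 0 (pderiv G)"
  define D where "D = smult (of_nat n) G - N"
  have N: "poly N w = w * poly (pderiv G) w" for w
    by (simp add: N_def)
  have D: "poly D w = of_nat n * poly G w - w * poly (pderiv G) w" for w
    by (simp add: D_def N)
  have ND: "cmod (poly N w) \<le> cmod (poly D w)" if "w \<in> ball 0 k" for w
    using cmod_pderiv_le[OF deg nz that] by (simp add: N D)
  \<comment> \<open>A zero of \<open>D\<close> would by \<open>ND\<close> be a zero of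
    \<open>N\<close>, hence of \<open>n G = D + N\<close>.\<close>
  have Dnz: "poly D w \<noteq> 0" if "w \<in> ball 0 k" for w
    using ND[OF that] nz that n by (auto simp: N D)
  \<comment> \<open>Index \<open>0\<close> is covered by the factor \<open>z\<close> in
    \<open>N = z G'\<close>, the other indices by \<open>lac\<close>.\<close>
  have "coeff N v = 0" if "v < \<mu>" for v
    using that lac by (cases v) (auto simp: N_def coeff_pderiv)
  then obtain H where H: "N = monom 1 \<mu> * H"
    using monom_1_dvd_iff' by (metis dvdE)
  have NH: "cmod (poly N w) = cmod w ^ \<mu> * cmod (poly H w)" for w
    by (simp add: H poly_monom norm_mult norm_power)
  have inner: "k ^ \<mu> * cmod (poly H w) \<le> cmod (poly D w)" if w: "w \<in> ball 0 k" for w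
  proof -
    \<comment> \<open>\<open>D\<close> may vanish on \<open>|z| = k\<close>, so the maximum
      principle is applied to \<open>H / D\<close> on smaller disks, and \<open>r\<close> then tends
      to \<open>k\<close>.\<close>
    have step: "r ^ \<mu> * cmod (poly H w) \<le> cmod (poly D w)" if r: "cmod w < r" "r < k" for r
    proof -
      have rpos: "r > 0" using r(1) norm_ge_zero[of w] by linarith
      have Dr: "poly D u \<noteq> 0" if "cmod u \<le> r" for u
        using Dnz[of u] that r by simp
      have "cmod (poly H w / poly D w) \<le> 1 / r ^ \<mu>"
      proof (rule maximum_modulus_frontier[where S = "cball 0 r" and f = "\<lambda>w. poly H w / poly D w"])
        show "(\<lambda>w. poly H w / poly D w) holomorphic_on interior (cball 0 r)"
          by (intro holomorphic_intros) (auto simp: Dr)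
        show "continuous_on (closure (cball 0 r)) (\<lambda>w. poly H w / poly D w)"
          by (intro continuous_intros) (auto simp: Dr)
        show "cmod (poly H u / poly D u) \<le> 1 / r ^ \<mu>" if "u \<in> frontier (cball 0 r)" for u
        proof -
          have u: "cmod u = r" using that rpos by (simp add: frontier_cball)
          then have "u \<in> ball 0 k" using r by simp
          with ND[of u] Dnz[of u] u rpos show ?thesis
            unfolding NH by (simp add: norm_divide divide_simps mult.commute)
        qed
      qed (use r in auto)
      with Dnz[OF w] rpos show ?thesis
        by (simp add: norm_divide divide_simps mult.commute)
    qed
    have "((\<lambda>r. r ^ \<mu> * cmod (poly H w)) \<longlongrightarrow> k ^ \<mu> * cmod (poly H w)) (at_left k)"
      by (intro tendsto_intros)
    moreover have "eventually (\<lambda>r. r ^ \<mu> * cmod (poly H w) \<le> cmod (poly D w)) (at_left k)"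
      using eventually_at_left_real[of "cmod w" k] w by (auto elim!: eventually_mono intro: step)
    ultimately show ?thesis
      by (rule tendsto_upperbound) simp
  qed
  \<comment> \<open>Free of quotients, the inequality extends to the boundary circle by
    continuity.\<close>
  have "0 \<le> cmod z ^ \<mu> * cmod (poly D z) - k ^ \<mu> * cmod (poly N z)"
  proof (rule continuous_ge_on_closure[where f = "\<lambda>w. cmod w ^ \<mu> * cmod (poly D w) - k ^ \<mu> * cmod (poly N w)"])
    show "continuous_on (closure (ball 0 k)) (\<lambda>w. cmod w ^ \<mu> * cmod (poly D w) - k ^ \<mu> * cmod (poly N w))"
      by (intro continuous_intros)
    show "z \<in> closure (ball 0 k)" using z k by simp
    show "0 \<le> cmod w ^ \<mu> * cmod (poly D w) - k ^ \<mu> * cmod (poly N w)" if "w \<in> ball 0 k" for w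
      using mult_left_mono[OF inner[OF that], of "cmod w ^ \<mu>"] by (simp add: NH mult.left_commute)
  qed
  then show ?thesis by (simp add: N D)
qed

section \<open>Derivative bounds from shifts by a constant\<close>

text \<open>Taking \<open>c\<close> in the direction of \<open>w\<close> turns the subtraction into
  one of moduli. For \<open>w = 0\<close>, where \<open>sgn w\<close> vanishes, any direction will
  do.\<close>

lemma exists_scaled_norm_diff:
  fixes w :: complex
  assumes "t \<ge> 0"
  shows "\<exists>c. cmod c = t \<and> cmod (w - of_real m * c) = \<bar>cmod w - m * t\<bar>"
proof (cases "w = 0")
  case True
  with assms show ?thesis by (intro exI[of _ "of_real t"]) (simp add: norm_mult abs_mult)
next
  case False
  have "w = of_real (cmod w) * sgn w"
    using False by (simp add: sgn_div_norm scaleR_conv_of_real)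
  then have "w - of_real m * (of_real t * sgn w) = of_real (cmod w - m * t) * sgn w"
    by (metis (no_types, opaque_lifting) left_diff_distrib mult.assoc of_real_diff of_real_mult)
  then have "cmod (w - of_real m * (of_real t * sgn w)) = \<bar>cmod w - m * t\<bar>"
    using False by (simp only: norm_mult norm_sgn norm_of_real) simp
  with assms False show ?thesis
    by (intro exI[of _ "of_real t * sgn w"]) (simp add: norm_mult norm_sgn)
qed

lemma pderiv_add_reverse_le:
  assumes "degree p \<le> n" "z \<in> sphere 0 1"
  shows "cmod (poly (pderiv p) z) + cmod (of_nat n * poly p z - z * poly (pderiv p) z)
           \<le> real n * max_modulus 1 p"
proof -
  define w where "w = of_nat n * poly p z - z * poly (pderiv p) z"
  define M where "M = max_modulus 1 p"
  have z: "cmod z = 1" using assms(2) by simp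
  have M: "cmod (poly p u) \<le> M" if "u \<in> cball 0 1" for u
    using poly_max_modulus_principle[OF that] by (simp add: M_def)
  have M0: "M \<ge> 0" using order_trans[OF norm_ge_zero M[of 0]] by simp
  have shift: "cmod (poly (pderiv p) z) \<le> \<bar>cmod w - real n * t\<bar>" if t: "t > M" for t
  proof -
    obtain c where c: "cmod c = t" "cmod (w - of_real (real n) * c) = \<bar>cmod w - real n * t\<bar>"
      using exists_scaled_norm_diff[of t w "real n"] order_trans[OF M0 less_imp_le[OF t]] by blast
    have nz: "\<forall>u\<in>ball 0 1. poly (p - [:c:]) u \<noteq> 0"
    proof
      fix u :: complex assume "u \<in> ball 0 1"
      then have "cmod (poly p u) < cmod c" using M[of u] t c(1) by simp
      then show "poly (p - [:c:]) u \<noteq> 0" by auto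
    qed
    have "degree (p - [:c:]) \<le> n"
      using assms(1) by (intro degree_diff_le) auto
    from lacunary_pderiv_le[OF this, of 0 1 z] nz z c(2) show ?thesis
      by (simp add: w_def pderiv_diff pderiv_pCons norm_mult algebra_simps)
  qed
  \<comment> \<open>This fixes the sign inside the absolute value. Otherwise
    \<open>t = |w| / n\<close> would be admissible in \<open>shift\<close> and force
    \<open>p'(z) = 0\<close>, so \<open>|w| = n |p(z)|\<close>, which is at most
    \<open>n M\<close>.\<close>
  have "cmod w \<le> real n * M"
  proof (rule ccontr)
    assume a: "\<not> cmod w \<le> real n * M"
    have n: "n \<noteq> 0"
    proof
      assume "n = 0"
      with assms(1) have "pderiv p = 0" by (simp add: pderiv_eq_0_iff)
      with \<open>n = 0\<close> have "w = 0" by (simp add: w_def)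
      with a \<open>n = 0\<close> show False by simp
    qed
    with a have "cmod w / real n > M" by (simp add: field_simps)
    from shift[OF this] n have "poly (pderiv p) z = 0" by simp
    then have "cmod w = real n * cmod (poly p z)" by (simp add: w_def norm_mult)
    with a M[of z] z mult_left_mono[of "cmod (poly p z)" M "real n"] show False by simp
  qed
  moreover have "cmod (poly (pderiv p) z) \<le> \<bar>cmod w - real n * M\<bar>"
  proof (rule tendsto_lowerbound)
    show "((\<lambda>t. \<bar>cmod w - real n * t\<bar>) \<longlongrightarrow> \<bar>cmod w - real n * M\<bar>) (at_right M)"
      by (intro tendsto_intros)
    show "eventually (\<lambda>t. cmod (poly (pderiv p) z) \<le> \<bar>cmod w - real n * t\<bar>) (at_right M)"
      using eventually_at_right_less by (rule eventually_mono) (rule shift)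
  qed simp
  ultimately show ?thesis by (simp add: w_def M_def)
qed

lemma lacunary_pderiv_le_reverse_minus_min:
  assumes deg: "degree q \<le> m" and lac: "\<forall>v. 0 < v \<and> v < \<mu> \<longrightarrow> coeff q v = 0"
    and nz: "\<forall>w\<in>ball 0 k. poly q w \<noteq> 0" and k: "k \<ge> 1" and z: "z \<in> sphere 0 1"
  shows "k ^ \<mu> * cmod (poly (pderiv q) z)
           \<le> cmod (of_nat m * poly q z - z * poly (pderiv q) z) - real m * min_modulus k q"
proof -
  define w where "w = of_nat m * poly q z - z * poly (pderiv q) z"
  define b where "b = min_modulus k q"
  have z1: "cmod z = 1" using z by simp
  have b: "b \<le> cmod (poly q u)" if "u \<in> cball 0 k" for u
    using poly_min_modulus_principle[OF nz that] k by (simp add: b_def)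
  have b0: "b \<ge> 0"
    using min_modulus_attained[of k q] k by (auto simp: b_def dest: sym)
  \<comment> \<open>The alternative \<open>t = 0\<close> serves the case \<open>b = 0\<close>, in
    which no \<open>t \<ge> 0\<close> lies below \<open>b\<close>.\<close>
  have shift: "k ^ \<mu> * cmod (poly (pderiv q) z) \<le> \<bar>cmod w - real m * t\<bar>"
    if t: "t \<ge> 0" "t < b \<or> t = 0" for t
  proof -
    obtain c where c: "cmod c = t" "cmod (w - of_real (real m) * c) = \<bar>cmod w - real m * t\<bar>"
      using exists_scaled_norm_diff[OF t(1), of w "real m"] by blast
    have nz': "\<forall>u\<in>ball 0 k. poly (q - [:c:]) u \<noteq> 0"
    proof
      fix u :: complex assume u: "u \<in> ball 0 k"
      from t(2) show "poly (q - [:c:]) u \<noteq> 0"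
      proof
        assume "t < b"
        then have "cmod c < cmod (poly q u)" using b[of u] u c(1) by simp
        then show ?thesis by auto
      next
        assume "t = 0"
        then show ?thesis using c(1) nz u by simp
      qed
    qed
    have "degree (q - [:c:]) \<le> m"
      using deg by (intro degree_diff_le) auto
    \<comment> \<open>The shift changes only the constant coefficient, so the gap survives.\<close>
    moreover have "\<forall>v. 0 < v \<and> v < \<mu> \<longrightarrow> coeff (q - [:c:]) v = 0"
      using lac by (auto simp: coeff_pCons split: nat.split)
    ultimately show ?thesis
      using lacunary_pderiv_le[of "q - [:c:]" m \<mu> k z] nz' z1 k c(2)
      by (simp add: w_def pderiv_diff pderiv_pCons norm_mult algebra_simps)
  qed
  \<comment> \<open>Again \<open>t = |w| / m\<close> would be admissible and give
    \<open>q'(z) = 0\<close>, hence \<open>|w| = m |q(z)| \<ge> m b\<close>.\<close>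
  have "real m * b \<le> cmod w"
  proof (rule ccontr)
    assume a: "\<not> real m * b \<le> cmod w"
    then have m: "m \<noteq> 0" by (cases "m = 0") auto
    with a have "cmod w / real m < b" by (simp add: field_simps)
    moreover have "k ^ \<mu> > 0" using k by simp
    ultimately have "poly (pderiv q) z = 0"
      using shift[of "cmod w / real m"] m by (simp add: mult_le_0_iff)
    then have "cmod w = real m * cmod (poly q z)" by (simp add: w_def norm_mult)
    with a b[of z] z1 k mult_left_mono[of b "cmod (poly q z)" "real m"] show False by simp
  qed
  moreover have "k ^ \<mu> * cmod (poly (pderiv q) z) \<le> \<bar>cmod w - real m * b\<bar>"
  proof (cases "b = 0")
    case True
    with shift[of 0] show ?thesis by simp
  next
    case False
    show ?thesis
    proof (rule tendsto_lowerbound)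
      show "((\<lambda>t. \<bar>cmod w - real m * t\<bar>) \<longlongrightarrow> \<bar>cmod w - real m * b\<bar>) (at_left b)"
        by (intro tendsto_intros)
      show "eventually (\<lambda>t. k ^ \<mu> * cmod (poly (pderiv q) z) \<le> \<bar>cmod w - real m * t\<bar>) (at_left b)"
        using eventually_at_left_real[of 0 b] False b0
        by (auto elim!: eventually_mono intro: shift)
    qed simp
  qed
  ultimately show ?thesis by (simp add: w_def b_def)
qed

lemma lacunary_pderiv_bound:
  assumes "degree q \<le> m" "\<forall>v. 0 < v \<and> v < \<mu> \<longrightarrow> coeff q v = 0"
    and "\<forall>w\<in>ball 0 k. poly q w \<noteq> 0" "k \<ge> 1" "z \<in> sphere 0 1"
  shows "cmod (poly (pderiv q) z)
           \<le> real m / (1 + k ^ \<mu>) * (max_modulus 1 q - min_modulus k q)"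
proof -
  have "(1 + k ^ \<mu>) * cmod (poly (pderiv q) z) \<le> real m * (max_modulus 1 q - min_modulus k q)"
    using lacunary_pderiv_le_reverse_minus_min[OF assms] pderiv_add_reverse_le[OF assms(1,5)]
    by (simp add: algebra_simps)
  moreover have "1 + k ^ \<mu> > 0" using assms(4) by (simp add: add_pos_nonneg)
  ultimately show ?thesis by (simp add: field_simps)
qed

section \<open>The polar derivative and the factor \<open>(z - z\<^sub>0)^s\<close>\<close>

text \<open>In \<open>|\<alpha>| = 1 + (|\<alpha>| - 1)\<close> the share \<open>1\<close> of
  \<open>|p'|\<close> is absorbed, together with \<open>|n p - z p'|\<close>, by
  \<open>pderiv_add_reverse_le\<close>.\<close>

lemma polar_deriv_le:
  assumes "z \<in> sphere 0 1" "cmod \<alpha> \<ge> 1"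
  shows "cmod (poly (polar_deriv \<alpha> p) z)
           \<le> real (degree p) * max_modulus 1 p + (cmod \<alpha> - 1) * cmod (poly (pderiv p) z)"
proof -
  have "poly (polar_deriv \<alpha> p) z
      = (of_nat (degree p) * poly p z - z * poly (pderiv p) z) + \<alpha> * poly (pderiv p) z"
    by (simp add: poly_polar_deriv algebra_simps)
  then have "cmod (poly (polar_deriv \<alpha> p) z)
      \<le> cmod (of_nat (degree p) * poly p z - z * poly (pderiv p) z) + cmod \<alpha> * cmod (poly (pderiv p) z)"
    by (metis norm_mult norm_triangle_ineq)
  with pderiv_add_reverse_le[OF order_refl assms(1), of p] show ?thesis
    by (simp add: algebra_simps)
qed

theorem theorem3:
  fixes n s \<mu> :: nat and p q :: "complex poly" and a :: "nat \<Rightarrow> complex"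
    and z\<^sub>0 \<alpha> :: complex and k A :: real
  assumes "s < n" and "1 \<le> \<mu>" and "\<mu> \<le> n - s"
    and "degree p = n"
    and "q = [:a 0:] + (\<Sum>v=\<mu>..n - s. monom (a v) v)"
    and "p = [:- z\<^sub>0, 1:] ^ s * q"
    and "k \<ge> 1" and "cmod \<alpha> \<ge> 1"
    and "z\<^sub>0 \<in> ball 0 1"
    and "\<forall>z. poly q z = 0 \<longrightarrow> z \<notin> ball 0 k"
    and "A = (1 + cmod z\<^sub>0) ^ (s + 1) * real (n - s) / ((1 + k ^ \<mu>) * (1 - cmod z\<^sub>0))"
  shows "max_modulus 1 (polar_deriv \<alpha> p) \<le>
           (real n + (cmod \<alpha> - 1) * (real s / (1 - cmod z\<^sub>0) + A / (1 - cmod z\<^sub>0) ^ s))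
             * max_modulus 1 p
           - ((cmod \<alpha> - 1) * A / (k + cmod z\<^sub>0) ^ s) * min_modulus k p"
proof -
  define d where "d = cmod z\<^sub>0"
  define M where "M = max_modulus 1 p"
  define b where "b = min_modulus k p"
  \<comment> \<open>The constant that the product rule yields; \<open>A\<close> exceeds it by the
    factor \<open>(1 + d) / (1 - d) \<ge> 1\<close>.\<close>
  define B where "B = (1 + d) ^ s * (real (n - s) / (1 + k ^ \<mu>))"
  have d: "0 \<le> d" "d < 1" using assms(9) by (auto simp: d_def)
  have kp: "1 + k ^ \<mu> > 0" using assms(7) by (simp add: add_pos_nonneg)
  have kd: "(k + d) ^ s > 0" using d assms(7) by simp
  have poly_p: "poly p z = (z - z\<^sub>0) ^ s * poly q z" for z
    by (simp add: assms(6))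
  have lower: "1 - d \<le> cmod (z - z\<^sub>0)" if "z \<in> sphere 0 1" for z
    using norm_triangle_ineq2[of z z\<^sub>0] that by (simp add: d_def)
  have upper: "cmod (z - z\<^sub>0) \<le> r + d" if "z \<in> sphere 0 r" for z r
    using norm_triangle_ineq4[of z z\<^sub>0] that by (simp add: d_def)
  have M: "cmod (poly p z) \<le> M" if "z \<in> sphere 0 1" for z
    using max_modulus_attained[of 1 p] that by (auto simp: M_def)
  have b: "b \<le> cmod (poly p z)" if "z \<in> sphere 0 k" for z
    using min_modulus_attained[of k p] that assms(7) by (auto simp: b_def)
  have "q \<noteq> 0" using assms(1,4,6) by auto
  then have deg: "degree q = n - s"
    using assms(4) unfolding assms(6) by (simp add: degree_mult_eq degree_power_eq)
  have lac: "\<forall>v. 0 < v \<and> v < \<mu> \<longrightarrow> coeff q v = 0"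
    by (auto simp: assms(5) coeff_sum coeff_pCons split: nat.split intro!: sum.neutral)
  have nz: "\<forall>w\<in>ball 0 k. poly q w \<noteq> 0"
    using assms(10) by blast
  have q_bound: "cmod (poly (pderiv q) z) \<le> real (n - s) / (1 + k ^ \<mu>) * (max_modulus 1 q - min_modulus k q)"
    if "z \<in> sphere 0 1" for z
    using lacunary_pderiv_bound[OF _ lac nz assms(7) that] deg by simp
  \<comment> \<open>Evaluated where \<open>|q|\<close> is maximal on the unit circle;
    \<open>bq\<close> below likewise uses a minimum point on \<open>|z| = k\<close>.\<close>
  have Mq: "max_modulus 1 q \<le> M / (1 - d) ^ s"
  proof -
    obtain w where w: "w \<in> sphere 0 1" "cmod (poly q w) = max_modulus 1 q"
      using max_modulus_attained[of 1 q] by auto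
    have "(1 - d) ^ s * cmod (poly q w) \<le> cmod (w - z\<^sub>0) ^ s * cmod (poly q w)"
      using lower[OF w(1)] d by (intro mult_right_mono power_mono) auto
    also have "\<dots> \<le> M"
      using M[OF w(1)] by (simp add: poly_p norm_mult norm_power)
    finally show ?thesis using w(2) d by (simp add: field_simps)
  qed
  have bq: "b / (k + d) ^ s \<le> min_modulus k q"
  proof -
    obtain w where w: "w \<in> sphere 0 k" "cmod (poly q w) = min_modulus k q"
      using min_modulus_attained[of k q] assms(7) by auto
    have "b \<le> cmod (w - z\<^sub>0) ^ s * cmod (poly q w)"
      using b[OF w(1)] by (simp add: poly_p norm_mult norm_power)
    also have "\<dots> \<le> (k + d) ^ s * cmod (poly q w)"
      using upper[OF w(1)] by (intro mult_right_mono power_mono) auto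
    finally show ?thesis using w(2) kd by (simp add: field_simps)
  qed
  \<comment> \<open>The sign is what permits replacing \<open>B\<close> by \<open>A\<close>. The
    point \<open>1\<close> links the two moduli of \<open>q\<close>: it lies on the unit circle and,
    as \<open>k \<ge> 1\<close>, in the closed disk of radius \<open>k\<close>.\<close>
  have gap: "M / (1 - d) ^ s - b / (k + d) ^ s \<ge> 0"
  proof -
    have "min_modulus k q \<le> cmod (poly q 1)"
      using poly_min_modulus_principle[OF nz, of 1] assms(7) by simp
    also have "\<dots> \<le> max_modulus 1 q"
      using poly_max_modulus_principle[of 1 1 q] by simp
    finally show ?thesis using Mq bq by linarith
  qed
  have BA: "0 \<le> B" "B \<le> A"
  proof -
    show B0: "0 \<le> B" using d kp by (simp add: B_def)
    have "A = B * ((1 + d) / (1 - d))"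
      by (simp add: assms(11) B_def d_def[symmetric] mult_ac)
    moreover have "(1 + d) / (1 - d) \<ge> 1" using d by simp
    ultimately show "B \<le> A" using B0 mult_left_mono[of 1 "(1 + d) / (1 - d)" B] by simp
  qed
  have p'_bound: "cmod (poly (pderiv p) z)
      \<le> real s / (1 - d) * M + A * (M / (1 - d) ^ s - b / (k + d) ^ s)"
    if z: "z \<in> sphere 0 1" for z
  proof -
    have zz: "z \<noteq> z\<^sub>0" using lower[OF z] d by auto
    \<comment> \<open>The first term is written through \<open>p\<close>, so that \<open>M\<close>
      bounds it directly without passing through \<open>max_modulus 1 q\<close>.\<close>
    have pd: "poly (pderiv p) z = of_nat s * poly p z / (z - z\<^sub>0) + (z - z\<^sub>0) ^ s * poly (pderiv q) z"
    proof (cases s)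
      case 0
      then show ?thesis by (simp add: assms(6))
    next
      case (Suc l)
      have "poly (pderiv p) z
          = of_nat s * (z - z\<^sub>0) ^ l * poly q z + (z - z\<^sub>0) ^ s * poly (pderiv q) z"
        unfolding assms(6) Suc pderiv_mult pderiv_power_Suc
        by (simp add: pderiv_pCons del: power_Suc of_nat_Suc)
      moreover have "of_nat s * poly p z / (z - z\<^sub>0) = of_nat s * (z - z\<^sub>0) ^ l * poly q z"
        using zz by (simp add: poly_p Suc)
      ultimately show ?thesis by simp
    qed
    have "cmod (of_nat s * poly p z / (z - z\<^sub>0)) \<le> real s * M / (1 - d)"
      unfolding norm_divide norm_mult
      using lower[OF z] M[OF z] order_trans[OF norm_ge_zero M[OF z]] d
      by (intro frac_le mult_mono mult_nonneg_nonneg) auto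
    moreover have "cmod ((z - z\<^sub>0) ^ s * poly (pderiv q) z)
        \<le> (1 + d) ^ s * (real (n - s) / (1 + k ^ \<mu>) * (max_modulus 1 q - min_modulus k q))"
      unfolding norm_mult norm_power
      using upper[OF z] q_bound[OF z] d by (intro mult_mono power_mono) auto
    moreover have "\<dots> = B * (max_modulus 1 q - min_modulus k q)"
      by (simp add: B_def)
    moreover have "\<dots> \<le> B * (M / (1 - d) ^ s - b / (k + d) ^ s)"
      using Mq bq BA by (intro mult_left_mono) auto
    moreover have "\<dots> \<le> A * (M / (1 - d) ^ s - b / (k + d) ^ s)"
      using BA gap by (intro mult_right_mono)
    ultimately show ?thesis
      unfolding pd by (intro order_trans[OF norm_triangle_ineq]) simp
  qed
  obtain w where w: "w \<in> sphere 0 1"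
      "cmod (poly (polar_deriv \<alpha> p) w) = max_modulus 1 (polar_deriv \<alpha> p)"
    using max_modulus_attained[of 1 "polar_deriv \<alpha> p"] by auto
  have "max_modulus 1 (polar_deriv \<alpha> p) \<le> real n * M + (cmod \<alpha> - 1) * cmod (poly (pderiv p) w)"
    using polar_deriv_le[OF w(1) assms(8), of p] w(2) assms(4) by (simp add: M_def)
  also have "\<dots> \<le> real n * M + (cmod \<alpha> - 1) * (real s / (1 - d) * M + A * (M / (1 - d) ^ s - b / (k + d) ^ s))"
    using p'_bound[OF w(1)] assms(8) by (intro add_left_mono mult_left_mono) auto
  also have "\<dots> = (real n + (cmod \<alpha> - 1) * (real s / (1 - d) + A / (1 - d) ^ s)) * M
      - ((cmod \<alpha> - 1) * A / (k + d) ^ s) * b"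
    by (simp add: ring_distribs mult_ac)
  finally show ?thesis
    by (simp add: M_def b_def d_def)
qed

end
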